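(* Let $(\mathbb{R}^n,g)$ be a pseudo-Euclidean space, $n\ge3$, with coordinates $x=(x_1,\dots,x_n)$ and $g_{ij}=\delta_{ij}\varepsilon_i$, $\varepsilon_i=\pm1$. Let $\xi=\sum_{i=1}^n\alpha_ix_i$ with $\alpha=(\alpha_1,\dots,\alpha_n)\in\mathbb{R}^n\setminus\{0\}$, where either $\sum_{i=1}^n\varepsilon_i\alpha_i^2=\varepsilon_{i_0}\in\{1,-1\}$ or $\sum_{i=1}^n\varepsilon_i\alpha_i^2=0$. Let $\varphi(\xi),f(\xi),h(\xi)$ be smooth functions of $\xi$, with $f$ positive and $\varphi$ nowhere zero. Consider $M=(\mathbb{R}^n,\overline g)\times_fF^m$, where $\overline g=\frac1{\varphi^2}g$ and $F^m$, $m\ge1$, is a semi-Riemannian Einstein manifold with constant Ricci curvature $\lambda_F$. Let $\rho\in\mathbb{R}$. Then the warped product metric $\widetilde g=\overline g+f^2g_F$ is a gradient Ricci soliton with $h$ as potential function, i.e. $\mathrm{Ric}_{\widetilde g}+\mathrm{Hess}_{\widetilde g}(h)=\rho\widetilde g$, if and only if $f,\varphi,h$ satisfy the following (where $'$ denotes $d/d\xi$): (i) whenever $\sum_{i=1}^n\varepsilon_i\alpha_i^2=\varepsilon_{i_0}$: $$\begin{cases}(n-2)f\varphi''+f\varphi h''-m\varphi f''-2m\varphi'f'+2f\varphi'h'=0,\\ \sum_{k=1}^n\varepsilon_k\alpha_k^2\big[f\varphi\varphi''-(n-1)f\varphi'^2+m\varphi\varphi'f'-f\varphi\varphi'h'\big]=\rho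 f,\\ \sum_{k=1}^n\varepsilon_k\alpha_k^2\big[-f\varphi^2f''+(n-2)f\varphi\varphi'f'-(m-1)\varphi^2f'^2+f\varphi^2f'h'\big]=\rho f^2-\lambda_F;\end{cases}$$ (ii) whenever $\sum_{i=1}^n\varepsilon_i\alpha_i^2=0$: $$(n-2)f\varphi''+f\varphi h''-m\varphi f''-2m\varphi'f'+2f\varphi'h'=0\quad\text{and}\quad\rho=\lambda_F=0.$$
   Context: The warped product $B\times_fF$ of semi-Riemannian manifolds $(B,g_B)$, $(F,g_F)$ with warping function $f>0$ on $B$ is $B\times F$ with metric $g_B+f^2g_F$. The function $h$ on $\mathbb{R}^n$ is regarded as a function on $M$ via the projection. $F$ having constant Ricci curvature $\lambda_F$ means $\mathrm{Ric}_{g_F}=\lambda_Fg_F$; when $m=1$, $\lambda_F=0$. *)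

theory Defs
  imports "HOL-Analysis.Analysis"
begin

section \<open>Smooth functions\<close>

text \<open>Only meant for open \<open>U\<close>. In finite dimension, asking for the directional derivatives in
  all directions \<open>v\<close> to be of class \<open>C\<^sup>k\<close> is the same as asking this of the derivative.\<close>

primrec Ck_on :: "nat \<Rightarrow> 'a::real_normed_vector set \<Rightarrow> ('a \<Rightarrow> 'b::real_normed_vector) \<Rightarrow> bool" where
  "Ck_on 0 U f = continuous_on U f"
| "Ck_on (Suc k) U f =
     ((\<forall>x\<in>U. f differentiable (at x)) \<and>
      (\<forall>v. Ck_on k U (\<lambda>x. frechet_derivative f (at x) v)))"

definition smooth_on :: "'a::real_normed_vector set \<Rightarrow> ('a \<Rightarrow> 'b::real_normed_vector) \<Rightarrow> bool" where
  "smooth_on U f \<longleftrightarrow> (\<forall>k. Ck_on k U f)"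

section \<open>Semi-Riemannian manifolds\<close>

text \<open>A manifold of dimension \<open>CARD('d)\<close> is a topology on (a subset of) the type \<open>'p\<close> with an
  atlas indexed by the set \<open>chart_ids\<close>. A metric is given classically, by its component matrix
  \<open>metric_comp M i p\<close> at the point \<open>p\<close> in each chart \<open>i\<close>. Only its values for
  \<open>i \<in> chart_ids M\<close> and \<open>p \<in> chart_dom M i\<close> matter.\<close>

record ('i, 'p, 'd) semi_riem =
  mtop :: "'p topology"
  chart_ids :: "'i set"
  chart_dom :: "'i \<Rightarrow> 'p set"
  chart :: "'i \<Rightarrow> 'p \<Rightarrow> real^'d"
  metric_comp :: "'i \<Rightarrow> 'p \<Rightarrow> real^'d^'d"

definition chart_inv :: "('i, 'p, 'd::finite) semi_riem \<Rightarrow> 'i \<Rightarrow> real^'d \<Rightarrow> 'p" where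
  "chart_inv M i = inv_into (chart_dom M i) (chart M i)"

definition transition :: "('i, 'p, 'd::finite) semi_riem \<Rightarrow> 'i \<Rightarrow> 'i \<Rightarrow> real^'d \<Rightarrow> real^'d" where
  "transition M i j = chart M j \<circ> chart_inv M i"

definition smooth_manifold :: "('i, 'p, 'd::finite) semi_riem \<Rightarrow> bool" where
  "smooth_manifold M \<longleftrightarrow>
     topspace (mtop M) \<noteq> {} \<and> Hausdorff_space (mtop M) \<and> second_countable (mtop M) \<and>
     (\<Union>i\<in>chart_ids M. chart_dom M i) = topspace (mtop M) \<and>
     (\<forall>i\<in>chart_ids M. openin (mtop M) (chart_dom M i) \<and> open (chart M i ` chart_dom M i) \<and>
        homeomorphic_map (subtopology (mtop M) (chart_dom M i))
          (top_of_set (chart M i ` chart_dom M i)) (chart M i)) \<and>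
     (\<forall>i\<in>chart_ids M. \<forall>j\<in>chart_ids M.
        smooth_on (chart M i ` (chart_dom M i \<inter> chart_dom M j)) (transition M i j))"

text \<open>The index of a symmetric bilinear form: the largest dimension of a subspace on which it is
  negative definite.\<close>

definition form_index :: "real^'d^'d::finite \<Rightarrow> nat" where
  "form_index A = Max {dim W | W. subspace W \<and> (\<forall>v\<in>W. v \<noteq> 0 \<longrightarrow> v \<bullet> (A *v v) < 0)}"

definition semi_riemannian_manifold :: "('i, 'p, 'd::finite) semi_riem \<Rightarrow> bool" where
  "semi_riemannian_manifold M \<longleftrightarrow>
     smooth_manifold M \<and>
     (\<forall>i\<in>chart_ids M. \<forall>a b.
        smooth_on (chart M i ` chart_dom M i) (\<lambda>x. metric_comp M i (chart_inv M i x) $ a $ b)) \<and>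
     (\<forall>i\<in>chart_ids M. \<forall>j\<in>chart_ids M. \<forall>p\<in>chart_dom M i \<inter> chart_dom M j. \<forall>v w.
        v \<bullet> (metric_comp M i p *v w) =
          (let J = frechet_derivative (transition M i j) (at (chart M i p))
           in J v \<bullet> (metric_comp M j p *v J w))) \<and>
     (\<forall>i\<in>chart_ids M. \<forall>p\<in>chart_dom M i.
        transpose (metric_comp M i p) = metric_comp M i p \<and> invertible (metric_comp M i p)) \<and>
     (\<exists>\<nu>. \<forall>i\<in>chart_ids M. \<forall>p\<in>chart_dom M i. form_index (metric_comp M i p) = \<nu>)"

section \<open>Curvature and Hessian in local coordinates\<close>

text \<open>The coordinate vector field \<open>\<partial>\<^sub>a\<close> of chart \<open>i\<close> applied to the function \<open>u\<close>.\<close>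

definition pd :: "('i, 'p, 'd::finite) semi_riem \<Rightarrow> 'i \<Rightarrow> 'd \<Rightarrow> ('p \<Rightarrow> real) \<Rightarrow> 'p \<Rightarrow> real" where
  "pd M i a u p = frechet_derivative (u \<circ> chart_inv M i) (at (chart M i p)) (axis a 1)"

text \<open>\<open>christoffel M i c a b\<close> is \<open>\<Gamma>\<^sup>c\<^sub>a\<^sub>b\<close>, i.e. the Levi-Civita connection is given by
  \<open>\<nabla>\<^sub>\<partial>\<^sub>a \<partial>\<^sub>b = (\<Sum>c. \<Gamma>\<^sup>c\<^sub>a\<^sub>b \<partial>\<^sub>c)\<close>.\<close>

definition christoffel ::
    "('i, 'p, 'd::finite) semi_riem \<Rightarrow> 'i \<Rightarrow> 'd \<Rightarrow> 'd \<Rightarrow> 'd \<Rightarrow> 'p \<Rightarrow> real" where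
  "christoffel M i c a b p =
     (\<Sum>e\<in>UNIV. matrix_inv (metric_comp M i p) $ c $ e *
        (pd M i a (\<lambda>q. metric_comp M i q $ b $ e) p
         + pd M i b (\<lambda>q. metric_comp M i q $ a $ e) p
         - pd M i e (\<lambda>q. metric_comp M i q $ a $ b) p)) / 2"

text \<open>\<open>riemann M i d c a b\<close> is the coefficient of \<open>\<partial>\<^sub>d\<close> in \<open>R(\<partial>\<^sub>a, \<partial>\<^sub>b)\<partial>\<^sub>c\<close>, where
  \<open>R(X, Y)Z = \<nabla>\<^sub>X \<nabla>\<^sub>Y Z - \<nabla>\<^sub>Y \<nabla>\<^sub>X Z - \<nabla>\<^sub>[\<^sub>X\<^sub>,\<^sub>Y\<^sub>] Z\<close>. The Ricci tensor is the trace of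
  \<open>X \<mapsto> R(X, Y)Z\<close>; with these signs it is positive on round spheres.\<close>

definition riemann ::
    "('i, 'p, 'd::finite) semi_riem \<Rightarrow> 'i \<Rightarrow> 'd \<Rightarrow> 'd \<Rightarrow> 'd \<Rightarrow> 'd \<Rightarrow> 'p \<Rightarrow> real" where
  "riemann M i d c a b p =
     pd M i a (christoffel M i d b c) p - pd M i b (christoffel M i d a c) p
     + (\<Sum>e\<in>UNIV. christoffel M i d a e p * christoffel M i e b c p
                 - christoffel M i d b e p * christoffel M i e a c p)"

definition ricci :: "('i, 'p, 'd::finite) semi_riem \<Rightarrow> 'i \<Rightarrow> 'd \<Rightarrow> 'd \<Rightarrow> 'p \<Rightarrow> real" where
  "ricci M i b c p = (\<Sum>a\<in>UNIV. riemann M i a c a b p)"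

definition hess ::
    "('i, 'p, 'd::finite) semi_riem \<Rightarrow> ('p \<Rightarrow> real) \<Rightarrow> 'i \<Rightarrow> 'd \<Rightarrow> 'd \<Rightarrow> 'p \<Rightarrow> real" where
  "hess M u i a b p =
     pd M i a (pd M i b u) p - (\<Sum>c\<in>UNIV. christoffel M i c a b p * pd M i c u p)"

definition einstein_manifold :: "('i, 'p, 'd::finite) semi_riem \<Rightarrow> real \<Rightarrow> bool" where
  "einstein_manifold M lam \<longleftrightarrow>
     semi_riemannian_manifold M \<and>
     (\<forall>i\<in>chart_ids M. \<forall>p\<in>chart_dom M i. \<forall>a b.
        ricci M i a b p = lam * metric_comp M i p $ a $ b)"

text \<open>\<open>Ric + Hess(u) = \<rho> g\<close>, as an equality of tensor fields on \<open>M\<close>.\<close>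

definition gradient_ricci_soliton ::
    "('i, 'p, 'd::finite) semi_riem \<Rightarrow> ('p \<Rightarrow> real) \<Rightarrow> real \<Rightarrow> bool" where
  "gradient_ricci_soliton M u \<rho> \<longleftrightarrow>
     (\<forall>i\<in>chart_ids M. \<forall>p\<in>chart_dom M i. \<forall>a b.
        ricci M i a b p + hess M u i a b p = \<rho> * metric_comp M i p $ a $ b)"

section \<open>Pseudo-Euclidean space, conformal change, warped products\<close>

definition pseudo_euclidean :: "('d::finite \<Rightarrow> real) \<Rightarrow> (unit, real^'d, 'd) semi_riem" where
  "pseudo_euclidean \<epsilon> =
     \<lparr> mtop = euclidean,
       chart_ids = {()},
       chart_dom = (\<lambda>_. UNIV),
       chart = (\<lambda>_ x. x),
       metric_comp = (\<lambda>_ _. \<chi> a b. if a = b then \<epsilon> a else 0) \<rparr>"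

text \<open>The metric \<open>g\<close> is replaced by \<open>u g\<close>.\<close>

definition conformal ::
    "('p \<Rightarrow> real) \<Rightarrow> ('i, 'p, 'd::finite) semi_riem \<Rightarrow> ('i, 'p, 'd) semi_riem" where
  "conformal u M = M \<lparr> metric_comp := (\<lambda>i p. u p *\<^sub>R metric_comp M i p) \<rparr>"

definition join_vec :: "real^'a::finite \<Rightarrow> real^'b::finite \<Rightarrow> real^('a + 'b)" where
  "join_vec x y = (\<chi> k. case k of Inl a \<Rightarrow> x $ a | Inr b \<Rightarrow> y $ b)"

definition block_diag ::
    "real^'a^'a::finite \<Rightarrow> real^'b^'b::finite \<Rightarrow> real^('a + 'b)^('a + 'b)" where
  "block_diag A B =
     (\<chi> k l. case (k, l) of
        (Inl a, Inl b) \<Rightarrow> A $ a $ b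
      | (Inr a, Inr b) \<Rightarrow> B $ a $ b
      | _ \<Rightarrow> 0)"

text \<open>The warped product \<open>B \<times>\<^sub>f F\<close>: the product manifold with the product atlas and the metric
  \<open>g\<^sub>B + f\<^sup>2 g\<^sub>F\<close>.\<close>

definition warped_product ::
    "('i, 'p, 'a::finite) semi_riem \<Rightarrow> ('p \<Rightarrow> real) \<Rightarrow> ('j, 'q, 'b::finite) semi_riem
      \<Rightarrow> ('i \<times> 'j, 'p \<times> 'q, 'a + 'b) semi_riem" where
  "warped_product B f F =
     \<lparr> mtop = prod_topology (mtop B) (mtop F),
       chart_ids = chart_ids B \<times> chart_ids F,
       chart_dom = (\<lambda>(i, j). chart_dom B i \<times> chart_dom F j),
       chart = (\<lambda>(i, j) (p, q). join_vec (chart B i p) (chart F j q)),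
       metric_comp = (\<lambda>(i, j) (p, q).
         block_diag (metric_comp B i p) ((f p)\<^sup>2 *\<^sub>R metric_comp F j q)) \<rparr>"

end

theory Submission
  imports Defs
begin

text \<open>In a product chart every component of the warped metric, of its Christoffel symbols and of
  the Hessian of \<open>h\<close> is a function of \<open>\<xi>\<close> times a function on \<open>F\<close>. With
  \<open>\<theta> = \<phi>'/\<phi>\<close>, \<open>L = f'/f\<close> and \<open>Q = f f' \<phi>\<^sup>2\<close>, the tensor \<open>Ric + Hess h - \<rho> g\<close> has no mixed
  components; it is \<open>A(\<xi>) \<alpha>\<^sub>a\<alpha>\<^sub>b + B(\<xi>) \<epsilon>\<^sub>a\<delta>\<^sub>a\<^sub>b\<close> along the base and \<open>C(\<xi>) g\<^sub>F\<close> along the fibre. A rank-one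
  matrix is not a nonzero multiple of the nondegenerate diagonal matrix (as \<open>n \<ge> 2\<close>), so the soliton equation
  means \<open>A = B = C = 0\<close>. Up to nonvanishing factors these are the three equations of the system,
  and for \<open>S = 0\<close> the last two degenerate to \<open>\<rho> = 0\<close> and \<open>\<lambda>\<^sub>F = \<rho> f\<^sup>2\<close>.\<close>

section \<open>Matrices and differentiability\<close>

text \<open>\<open>matrix_inv\<close> is a chosen two-sided inverse. For square matrices a right
  inverse is also a left inverse, and two-sided inverses are unique, so exhibiting one right inverse
  determines the choice.\<close>

lemma matrix_inv_eqI:
  fixes A B :: "real^'d::finite^'d"
  assumes "A ** B = mat 1"
  shows "matrix_inv A = B"
proof -
  have BA: "B ** A = mat 1"
    using assms by (simp add: matrix_left_right_inverse)
  have "A ** matrix_inv A = mat 1 \<and> matrix_inv A ** A = mat 1"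
    unfolding matrix_inv_def by (rule someI[of _ B]) (simp add: assms BA)
  then have "(B ** A) ** matrix_inv A = B"
    by (simp add: matrix_mul_assoc[symmetric])
  then show ?thesis
    by (simp add: BA)
qed

lemma matrix_inv_right_mult:
  fixes A :: "real^'d::finite^'d"
  assumes "invertible A"
  shows "A ** matrix_inv A = mat 1"
  using assms matrix_inv_eqI unfolding invertible_def by metis

text \<open>Column \<open>e\<close> of the inverse solves \<open>A *v x = column e (mat 1)\<close>,
  so Cramer's rule writes each entry as a quotient of determinants in the entries of
  \<open>A\<close>. This reduces differentiability of the inverse to that of
  \<open>det\<close>.\<close>

lemma matrix_inv_cramer:
  fixes A :: "real^'d::finite^'d"
  assumes "invertible A"
  shows "matrix_inv A $ c $ e = det (\<chi> i j. if j = c then mat 1 $ i $ e else A $ i $ j) / det A"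
proof -
  have "A *v column e (matrix_inv A) = column e (mat 1)"
    using matrix_inv_right_mult[OF assms]
    by (simp add: vec_eq_iff matrix_vector_mult_def column_def matrix_matrix_mult_def)
  then have "column e (matrix_inv A) =
      (\<chi> k. det (\<chi> i j. if j = k then column e (mat 1) $ i else A $ i $ j) / det A)"
    using assms by (simp add: cramer invertible_det_nz)
  then show ?thesis
    by (simp add: vec_eq_iff column_def cong: if_cong)
qed

lemma differentiable_det:
  fixes A :: "'a::real_normed_vector \<Rightarrow> real^'d::finite^'d"
  assumes "\<And>i j. (\<lambda>x. A x $ i $ j) differentiable (at x)"
  shows "(\<lambda>x. det (A x)) differentiable (at x)"
proof -
  have "(\<lambda>x. \<Prod>i\<in>UNIV. A x $ i $ p i) differentiable (at x)" for p
  proof -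
    have "((\<lambda>x. A x $ i $ p i) has_derivative frechet_derivative (\<lambda>x. A x $ i $ p i) (at x)) (at x)" for i
      using assms by (simp add: frechet_derivative_works)
    from has_derivative_prod[OF this] show ?thesis
      by (rule differentiableI)
  qed
  then show ?thesis
    unfolding det_def
    by (intro differentiable_sum ballI differentiable_mult differentiable_const)
      (auto intro: finite_permutations)
qed

lemma differentiable_matrix_inv:
  fixes A :: "'a::real_normed_vector \<Rightarrow> real^'d::finite^'d"
  assumes "\<And>i j. (\<lambda>x. A x $ i $ j) differentiable (at x)"
    and "open U" "x \<in> U" and inv: "\<And>y. y \<in> U \<Longrightarrow> invertible (A y)"
  shows "(\<lambda>x. matrix_inv (A x) $ c $ e) differentiable (at x)"
proof -
  have "(\<lambda>x. if j = c then mat 1 $ i $ e else A x $ i $ j) differentiable (at x)" for i j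
    using assms(1) by (cases "j = c") auto
  then have "(\<lambda>y. det (\<chi> i j. if j = c then mat 1 $ i $ e else A y $ i $ j) / det (A y)) differentiable (at x)"
    using assms by (intro differentiable_divide differentiable_det)
      (auto simp: invertible_det_nz)
  then obtain D where "((\<lambda>y. det (\<chi> i j. if j = c then mat 1 $ i $ e else A y $ i $ j) / det (A y))
      has_derivative D) (at x)"
    unfolding differentiable_def by blast
  \<comment> \<open>Cramer's formula is available only at invertible matrices, so the derivative is
    transferred on the open set \<open>U\<close>.\<close>
  then have "((\<lambda>y. matrix_inv (A y) $ c $ e) has_derivative D) (at x)"
    using assms(2,3) by (rule has_derivative_transform_within_open) (simp add: matrix_inv_cramer inv)
  then show ?thesis
    unfolding differentiable_def by blast
qed

section \<open>Block-diagonal, scaled and diagonal matrices\<close>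

lemma all_sum_type: "(\<forall>k. P k) \<longleftrightarrow> (\<forall>a. P (Inl a)) \<and> (\<forall>b. P (Inr b))"
  by (metis sum.exhaust)

lemma sum_UNIV_sum_type:
  fixes u :: "'a::finite + 'b::finite \<Rightarrow> real"
  shows "(\<Sum>k\<in>UNIV. u k) = (\<Sum>a\<in>UNIV. u (Inl a)) + (\<Sum>b\<in>UNIV. u (Inr b))"
  by (simp add: UNIV_Plus_UNIV[symmetric] sum.Plus del: UNIV_Plus_UNIV)

lemma block_diag_nth [simp]:
  "block_diag A B $ Inl a $ Inl b = A $ a $ b"
  "block_diag A B $ Inr i $ Inr j = B $ i $ j"
  "block_diag A B $ Inl a $ Inr j = 0"
  "block_diag A B $ Inr i $ Inl b = 0"
  by (simp_all add: block_diag_def)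

lemma join_vec_nth [simp]:
  "join_vec x y $ Inl a = x $ a" "join_vec x y $ Inr b = y $ b"
  by (simp_all add: join_vec_def)

lemma matrix_inv_block_diag:
  assumes "invertible A" "invertible B"
  shows "matrix_inv (block_diag A B) = block_diag (matrix_inv A) (matrix_inv B)"
proof (rule matrix_inv_eqI)
  have "(\<Sum>k\<in>UNIV. A $ i $ k * matrix_inv A $ k $ j) = (if i = j then 1 else 0)" for i j
    using matrix_inv_right_mult[OF assms(1)]
    by (simp add: vec_eq_iff matrix_matrix_mult_def mat_def)
  moreover have "(\<Sum>k\<in>UNIV. B $ i $ k * matrix_inv B $ k $ j) = (if i = j then 1 else 0)" for i j
    using matrix_inv_right_mult[OF assms(2)]
    by (simp add: vec_eq_iff matrix_matrix_mult_def mat_def)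
  ultimately show "block_diag A B ** block_diag (matrix_inv A) (matrix_inv B) = mat 1"
    by (simp add: vec_eq_iff matrix_matrix_mult_def mat_def all_sum_type sum_UNIV_sum_type)
qed

lemma matrix_inv_scaleR:
  fixes A :: "real^'d::finite^'d"
  assumes "c \<noteq> 0" "invertible A"
  shows "invertible (c *\<^sub>R A)" "matrix_inv (c *\<^sub>R A) = inverse c *\<^sub>R matrix_inv A"
proof -
  have *: "(c *\<^sub>R A) ** (inverse c *\<^sub>R matrix_inv A) = mat 1"
    using assms(1) matrix_inv_right_mult[OF assms(2), symmetric]
    by (simp add: matrix_matrix_mult_def vec_eq_iff field_simps)
  then show "matrix_inv (c *\<^sub>R A) = inverse c *\<^sub>R matrix_inv A"
    by (rule matrix_inv_eqI)
  show "invertible (c *\<^sub>R A)"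
    using * by (auto simp: invertible_right_inverse)
qed

lemma matrix_inv_diag:
  fixes u :: "'d::finite \<Rightarrow> real"
  assumes "\<And>a. u a \<noteq> 0"
  shows "invertible (\<chi> a b. if a = b then u a else 0)"
    "matrix_inv (\<chi> a b. if a = b then u a else 0) = (\<chi> a b. if a = b then 1 / u a else 0)"
proof -
  have *: "(\<chi> a b. if a = b then u a else 0) ** (\<chi> a b. if a = b then 1 / u a else 0) = mat 1"
    using assms
    by (simp add: vec_eq_iff matrix_matrix_mult_def mat_def mult_delta_left sum.delta)
  then show "matrix_inv (\<chi> a b. if a = b then u a else 0) = (\<chi> a b. if a = b then 1 / u a else 0)"
    by (rule matrix_inv_eqI)
  show "invertible (\<chi> a b. if a = b then u a else 0)"
    using * by (auto simp: invertible_right_inverse)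
qed

section \<open>Smooth functions of one real variable\<close>

lemma differentiable_imp_DERIV_deriv:
  fixes u :: "real \<Rightarrow> real"
  assumes "u differentiable (at t)"
  shows "(u has_real_derivative deriv u t) (at t)" "frechet_derivative u (at t) 1 = deriv u t"
proof -
  show *: "(u has_real_derivative deriv u t) (at t)"
    using assms by (simp add: DERIV_deriv_iff_real_differentiable)
  then show "frechet_derivative u (at t) 1 = deriv u t"
    by (metis frechet_derivative_at has_field_derivative_def mult.right_neutral)
qed

text \<open>The Frechet derivative in direction 1 is the ordinary derivative, so two unfoldings of
  \<open>Ck_on\<close> show that \<open>deriv u\<close> and \<open>deriv (deriv u)\<close> are
  genuine derivatives.\<close>

lemma smooth_on_DERIV:
  fixes u :: "real \<Rightarrow> real"
  assumes "smooth_on UNIV u"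
  shows "(u has_real_derivative deriv u t) (at t)"
    and "(deriv u has_real_derivative deriv (deriv u) t) (at t)"
proof -
  have C2: "Ck_on (Suc (Suc 0)) UNIV u"
    using assms by (simp only: smooth_on_def)
  then have d: "u differentiable (at s)" for s
    by simp
  then show "(u has_real_derivative deriv u t) (at t)"
    by (rule differentiable_imp_DERIV_deriv)
  have "(\<lambda>s. frechet_derivative u (at s) 1) = deriv u"
    using d by (simp add: differentiable_imp_DERIV_deriv)
  moreover have "(\<lambda>s. frechet_derivative u (at s) 1) differentiable (at t)"
    using C2 by simp
  ultimately show "(deriv u has_real_derivative deriv (deriv u) t) (at t)"
    by (metis differentiable_imp_DERIV_deriv(1))
qed

section \<open>Coordinate derivatives in a chart\<close>

text \<open>Injectivity makes \<open>chart_inv\<close> a left inverse, and openness lets derivatives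
  be compared near a point. Both can be checked for a product chart directly, without first showing
  the product to be a \<open>smooth_manifold\<close>.\<close>

definition regular_chart :: "('i, 'p, 'd::finite) semi_riem \<Rightarrow> 'i \<Rightarrow> bool" where
  "regular_chart M i \<longleftrightarrow>
     inj_on (chart M i) (chart_dom M i) \<and> open (chart M i ` chart_dom M i)"

definition chart_differentiable ::
    "('i, 'p, 'd::finite) semi_riem \<Rightarrow> 'i \<Rightarrow> ('p \<Rightarrow> real) \<Rightarrow> 'p \<Rightarrow> bool" where
  "chart_differentiable M i u p \<longleftrightarrow> (u \<circ> chart_inv M i) differentiable (at (chart M i p))"

lemma regular_chartI:
  assumes "smooth_manifold M" "i \<in> chart_ids M"
  shows "regular_chart M i"
proof -
  have "homeomorphic_map (subtopology (mtop M) (chart_dom M i))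
      (top_of_set (chart M i ` chart_dom M i)) (chart M i)"
    and "openin (mtop M) (chart_dom M i)" and op: "open (chart M i ` chart_dom M i)"
    using assms by (auto simp: smooth_manifold_def)
  then have "inj_on (chart M i) (chart_dom M i)"
    by (simp add: homeomorphic_eq_everything_map Int_absorb1 openin_subset)
  then show ?thesis
    using op by (simp add: regular_chart_def)
qed

lemma chart_inv_chart [simp]:
  "regular_chart M i \<Longrightarrow> p \<in> chart_dom M i \<Longrightarrow> chart_inv M i (chart M i p) = p"
  by (simp add: chart_inv_def regular_chart_def)

lemma chart_inv_in_dom:
  "z \<in> chart M i ` chart_dom M i \<Longrightarrow> chart_inv M i z \<in> chart_dom M i"
  by (simp add: chart_inv_def inv_into_into)

lemma chart_chart_inv:
  "z \<in> chart M i ` chart_dom M i \<Longrightarrow> chart M i (chart_inv M i z) = z"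
  by (simp add: chart_inv_def f_inv_into_f)

text \<open>Since the chart image is open, derivatives depend only on values inside the chart
  domain, which is where formulas for components hold.\<close>

lemma has_derivative_chart_cong:
  assumes "regular_chart M i" "p \<in> chart_dom M i" "\<And>q. q \<in> chart_dom M i \<Longrightarrow> u q = v q"
  shows "((u \<circ> chart_inv M i) has_derivative D) (at (chart M i p)) \<longleftrightarrow>
    ((v \<circ> chart_inv M i) has_derivative D) (at (chart M i p))"
proof -
  have "(v \<circ> chart_inv M i has_derivative D) (at (chart M i p))"
    if "(u \<circ> chart_inv M i has_derivative D) (at (chart M i p))"
      "\<And>q. q \<in> chart_dom M i \<Longrightarrow> u q = v q" for u v
    using that(1) assms(1)[unfolded regular_chart_def, THEN conjunct2]
    by (rule has_derivative_transform_within_open)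
      (use assms(2) in \<open>auto intro: that(2) chart_inv_in_dom\<close>)
  then show ?thesis
    using assms(3) by metis
qed

text \<open>\<open>frechet_derivative\<close> chooses among all derivatives of a function. Both
  functions have the same set of derivatives at the point, so the choices agree even if that set is
  empty.\<close>

lemma pd_cong:
  assumes "regular_chart M i" "p \<in> chart_dom M i" "\<And>q. q \<in> chart_dom M i \<Longrightarrow> u q = v q"
  shows "pd M i a u p = pd M i a v p"
  unfolding pd_def frechet_derivative_def using has_derivative_chart_cong[OF assms] by simp

lemma pd_eqI:
  assumes "regular_chart M i" "p \<in> chart_dom M i"
    and "((\<lambda>z. u (chart_inv M i z)) has_derivative D) (at (chart M i p))"
  shows "pd M i a u p = D (axis a 1)"
  using frechet_derivative_at[OF assms(3)] by (simp add: pd_def o_def)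

lemma chart_differentiable_const [simp]: "chart_differentiable M i (\<lambda>_. c) p"
  by (simp add: chart_differentiable_def o_def)

lemma pd_const [simp]: "pd M i a (\<lambda>_. c) p = 0"
  by (simp add: pd_def o_def)

section \<open>Symmetry and differentiability of metric components and Christoffel symbols\<close>

lemma christoffel_sym:
  assumes "semi_riemannian_manifold M" "i \<in> chart_ids M" "p \<in> chart_dom M i"
  shows "christoffel M i c a b p = christoffel M i c b a p"
proof -
  have reg: "regular_chart M i"
    using assms by (auto intro: regular_chartI simp: semi_riemannian_manifold_def)
  have "metric_comp M i q $ a $ b = metric_comp M i q $ b $ a" if "q \<in> chart_dom M i" for q
  proof -
    have "transpose (metric_comp M i q) $ b $ a = metric_comp M i q $ b $ a"
      using assms that by (simp add: semi_riemannian_manifold_def)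
    then show ?thesis
      by (simp add: transpose_def)
  qed
  \<comment> \<open>The metric is known to be symmetric only over the chart domain, hence
    \<open>pd_cong\<close>. This handles the last term of the Christoffel formula; the first two are
    merely exchanged.\<close>
  then have "pd M i e (\<lambda>q. metric_comp M i q $ a $ b) p = pd M i e (\<lambda>q. metric_comp M i q $ b $ a) p" for e
    by (rule pd_cong[OF reg assms(3)])
  then show ?thesis
    by (simp add: christoffel_def add.commute)
qed

lemma metric_comp_differentiable:
  assumes M: "semi_riemannian_manifold M" "i \<in> chart_ids M" and p: "p \<in> chart_dom M i"
  shows "chart_differentiable M i (\<lambda>q. metric_comp M i q $ a $ b) p"
    and "chart_differentiable M i (pd M i c (\<lambda>q. metric_comp M i q $ a $ b)) p"
proof -
  let ?u = "\<lambda>z. metric_comp M i (chart_inv M i z) $ a $ b"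
  let ?U = "chart M i ` chart_dom M i"
  have reg: "regular_chart M i"
    using M by (auto intro: regular_chartI simp: semi_riemannian_manifold_def)
  have "smooth_on ?U ?u"
    using M by (simp add: semi_riemannian_manifold_def)
  then have C2: "Ck_on (Suc (Suc 0)) ?U ?u"
    by (simp only: smooth_on_def)
  then show "chart_differentiable M i (\<lambda>q. metric_comp M i q $ a $ b) p"
    using p by (simp add: chart_differentiable_def o_def)
  have "(\<lambda>z. frechet_derivative ?u (at z) (axis c 1)) differentiable (at (chart M i p))"
    using C2 p by simp
  then obtain D where D: "((\<lambda>z. frechet_derivative ?u (at z) (axis c 1)) has_derivative D) (at (chart M i p))"
    unfolding differentiable_def by blast
  \<comment> \<open>On the chart image \<open>chart\<close> inverts \<open>chart_inv\<close>, so
    there \<open>pd\<close> read in coordinates is the directional derivative of the coordinate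
    expression.\<close>
  have "((\<lambda>z. pd M i c (\<lambda>q. metric_comp M i q $ a $ b) (chart_inv M i z)) has_derivative D) (at (chart M i p))"
    using D reg[unfolded regular_chart_def, THEN conjunct2] imageI[OF p]
    by (rule has_derivative_transform_within_open) (simp add: pd_def chart_chart_inv o_def)
  then show "chart_differentiable M i (pd M i c (\<lambda>q. metric_comp M i q $ a $ b)) p"
    by (auto simp: chart_differentiable_def differentiable_def o_def)
qed

text \<open>Each symbol is a sum of products of inverse metric entries and first metric derivatives,
  both differentiable. For the fibre this is what permits differentiating its symbols inside the
  curvature of the warped product.\<close>

lemma christoffel_differentiable:
  assumes M: "semi_riemannian_manifold M" "i \<in> chart_ids M" and p: "p \<in> chart_dom M i"
  shows "chart_differentiable M i (christoffel M i c a b) p"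
proof -
  have reg: "regular_chart M i"
    using M by (auto intro: regular_chartI simp: semi_riemannian_manifold_def)
  have "(\<lambda>z. matrix_inv (metric_comp M i (chart_inv M i z)) $ c $ e) differentiable (at (chart M i p))" for e
  proof (rule differentiable_matrix_inv[where U = "chart M i ` chart_dom M i"])
    show "invertible (metric_comp M i (chart_inv M i z))" if "z \<in> chart M i ` chart_dom M i" for z
      using M chart_inv_in_dom[OF that] by (simp add: semi_riemannian_manifold_def)
  qed (use reg p metric_comp_differentiable(1)[OF assms] in
      \<open>auto simp: regular_chart_def chart_differentiable_def o_def\<close>)
  then show ?thesis
    using metric_comp_differentiable(2)[OF assms]
    unfolding chart_differentiable_def christoffel_def o_def
    by (intro differentiable_divide differentiable_sum ballI differentiable_mult differentiable_add
        differentiable_diff differentiable_const) auto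
qed

section \<open>Warped products over a conformally flat base\<close>

text \<open>The base has a single chart, so fixing a chart \<open>j\<close> of \<open>F\<close>
  fixes a product chart of the warped product. The Einstein equation of the fibre is supplied later,
  in \<open>soliton_in_chart\<close>.\<close>

locale warped_over_line =
  fixes \<epsilon> :: "'n::finite \<Rightarrow> real" and \<alpha> :: "real^'n" and \<phi> f :: "real \<Rightarrow> real"
    and F :: "('j, 'q, 'm::finite) semi_riem" and j :: 'j
  assumes sign: "\<epsilon> i \<in> {1, -1}"
    and smooth_\<phi>: "smooth_on UNIV \<phi>" and smooth_f: "smooth_on UNIV f"
    and f_pos: "f t > 0" and \<phi>_nz: "\<phi> t \<noteq> 0"
    and F: "semi_riemannian_manifold F" and j: "j \<in> chart_ids F"
begin

definition \<xi> :: "real^'n \<Rightarrow> real" where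
  "\<xi> x = (\<Sum>i\<in>UNIV. \<alpha> $ i * x $ i)"

definition S :: real where
  "S = (\<Sum>k\<in>UNIV. \<epsilon> k * (\<alpha> $ k)\<^sup>2)"

definition M :: "(unit \<times> 'j, (real^'n) \<times> 'q, 'n + 'm) semi_riem" where
  "M = warped_product
     (conformal (\<lambda>x. 1 / (\<phi> (\<xi> x))\<^sup>2) (pseudo_euclidean \<epsilon>)) (\<lambda>x. f (\<xi> x)) F"

text \<open>Under the conformal change by \<open>e^(2w)\<close> the Christoffel symbols of the flat
  metric become those of \<open>K\<close> with \<open>dw\<close> in place of \<alpha>. Here
  \<open>w = - ln |\<phi>|\<close>, so \<open>dw\<close> is \<alpha> times minus the logarithmic
  derivative of \<phi>.\<close>

definition K :: "'n \<Rightarrow> 'n \<Rightarrow> 'n \<Rightarrow> real" where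
  "K c a b = (if c = a then \<alpha> $ b else 0) + (if c = b then \<alpha> $ a else 0)
     - (if a = b then \<epsilon> a * \<epsilon> c * \<alpha> $ c else 0)"

abbreviation "i \<equiv> ((), j)"
abbreviation "\<Gamma> \<equiv> christoffel F j"
abbreviation "g \<equiv> (\<lambda>q. metric_comp F j q)"

lemma sign_sq [simp]: "\<epsilon> a * \<epsilon> a = 1" "\<epsilon> a * (\<epsilon> a * x) = x" "\<epsilon> a \<noteq> 0"
  using sign[of a] by auto

lemma regF: "regular_chart F j"
  using F j by (auto intro: regular_chartI simp: semi_riemannian_manifold_def)

lemma chart_dom_M [simp]: "chart_dom M i = UNIV \<times> chart_dom F j"
  by (simp add: M_def warped_product_def conformal_def pseudo_euclidean_def)

lemma chart_M [simp]: "chart M i (x, q) = join_vec x (chart F j q)"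
  by (simp add: M_def warped_product_def conformal_def pseudo_euclidean_def)

lemma metric_comp_M: "metric_comp M i (x, q) =
    block_diag (\<chi> a b. if a = b then \<epsilon> a / (\<phi> (\<xi> x))\<^sup>2 else 0) ((f (\<xi> x))\<^sup>2 *\<^sub>R g q)"
  by (simp add: M_def warped_product_def conformal_def pseudo_euclidean_def block_diag_def
      vec_eq_iff all_sum_type)

text \<open>The base chart is onto, so only the fibre coordinates are constrained. As a preimage
  under a linear projection the image is visibly open.\<close>

lemma image_chart_M:
  "chart M i ` chart_dom M i = (\<lambda>z. \<chi> k. z $ Inr k) -` (chart F j ` chart_dom F j)"
proof -
  have "z \<in> chart M i ` chart_dom M i" if "(\<chi> k. z $ Inr k) = chart F j q" "q \<in> chart_dom F j" for z q
  proof (rule image_eqI)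
    show "z = chart M i (\<chi> a. z $ Inl a, q)"
      using that by (simp add: vec_eq_iff all_sum_type)
  qed (use that in auto)
  then show ?thesis
    by (auto simp: vec_eq_iff)
qed

lemma regM: "regular_chart M i"
proof -
  have "open (chart M i ` chart_dom M i)"
    unfolding image_chart_M using regF
    by (intro open_vimage continuous_intros) (simp add: regular_chart_def)
  moreover have "inj_on (chart M i) (chart_dom M i)"
    using regF by (auto simp: regular_chart_def inj_on_def vec_eq_iff all_sum_type)
  ultimately show ?thesis
    by (simp add: regular_chart_def)
qed

section \<open>Coordinate derivatives of separated functions\<close>

lemma \<xi>_axis: "\<xi> (axis a 1) = \<alpha> $ a"
  by (simp add: \<xi>_def axis_def mult_delta_right sum.delta)

lemma \<xi>_linear: "bounded_linear \<xi>"
  unfolding linear_conv_bounded_linear[symmetric]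
  by (rule linearI) (simp_all add: \<xi>_def algebra_simps sum.distrib sum_distrib_left)

text \<open>In a product chart, base directions differentiate only \<open>V\<close>, with \<alpha>
  from the chain rule through \<xi>, and fibre directions only \<open>w\<close>. The later
  derivatives of components reduce to this rule or to the derivative of a constant.\<close>

lemma pd_separated:
  assumes u: "\<And>x q. q \<in> chart_dom F j \<Longrightarrow> u (x, q) = V (\<xi> x) * w q"
    and V: "(V has_real_derivative V') (at (\<xi> x))"
    and w: "chart_differentiable F j w q" and q: "q \<in> chart_dom F j"
  shows "pd M i (Inl a) u (x, q) = \<alpha> $ a * V' * w q"
    and "pd M i (Inr k) u (x, q) = V (\<xi> x) * pd F j k w q"
proof -
  let ?l = "\<lambda>z::real^('n + 'm). \<chi> a. z $ Inl a" and ?r = "\<lambda>z::real^('n + 'm). \<chi> k. z $ Inr k"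
  let ?z = "join_vec x (chart F j q)"
  obtain D where D: "((\<lambda>y. w (chart_inv F j y)) has_derivative D) (at (chart F j q))"
    using w by (auto simp: chart_differentiable_def differentiable_def o_def)
  have "linear ?l" "linear ?r"
    by (auto intro!: linearI simp: vec_eq_iff)
  then have lin: "bounded_linear ?l" "bounded_linear ?r"
    by (simp_all only: linear_conv_bounded_linear)
  have z: "?l ?z = x" "?r ?z = chart F j q"
    by (simp_all add: vec_eq_iff)
  have DV: "((\<lambda>z. V (\<xi> (?l z))) has_derivative (\<lambda>d. V' * \<xi> (?l d))) (at ?z)"
  proof (rule has_derivative_compose[where f = "\<lambda>z. \<xi> (?l z)" and f' = "\<lambda>d. \<xi> (?l d)" and g' = "(*) V'"])
    show "((\<lambda>z. \<xi> (?l z)) has_derivative (\<lambda>d. \<xi> (?l d))) (at ?z)"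
      by (intro bounded_linear_imp_has_derivative bounded_linear_compose[OF \<xi>_linear lin(1)])
    show "(V has_derivative (*) V') (at (\<xi> (?l ?z)))"
      using V unfolding z by (simp add: has_field_derivative_def)
  qed
  have Dw: "((\<lambda>z. w (chart_inv F j (?r z))) has_derivative (\<lambda>d. D (?r d))) (at ?z)"
  proof (rule has_derivative_compose[OF bounded_linear_imp_has_derivative[OF lin(2)]])
    show "((\<lambda>y. w (chart_inv F j y)) has_derivative D) (at (?r ?z))"
      unfolding z by (rule D)
  qed
  have "((\<lambda>z. V (\<xi> (?l z)) * w (chart_inv F j (?r z))) has_derivative
      (\<lambda>d. V (\<xi> x) * D (?r d) + V' * \<xi> (?l d) * w q)) (at ?z)"
    using has_derivative_mult[OF DV Dw] unfolding z chart_inv_chart[OF regF q] .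
  \<comment> \<open>The product formula for \<open>u\<close> is assumed only over the fibre chart,
    so it is used on the open chart image alone.\<close>
  then have "((\<lambda>z. u (chart_inv M i z)) has_derivative
      (\<lambda>d. V (\<xi> x) * D (?r d) + V' * \<xi> (?l d) * w q)) (at ?z)"
  proof (rule has_derivative_transform_within_open)
    show "open (chart M i ` chart_dom M i)"
      using regM by (simp add: regular_chart_def)
    show "?z \<in> chart M i ` chart_dom M i"
      using q by force
    fix z assume "z \<in> chart M i ` chart_dom M i"
    then obtain x' q' where z': "z = chart M i (x', q')" "q' \<in> chart_dom F j"
      by auto
    then have "chart_inv M i z = (x', q')"
      using regM by (simp del: chart_M)
    moreover have "?l z = x'" "?r z = chart F j q'"
      using z' by (simp_all add: vec_eq_iff)
    ultimately show "V (\<xi> (?l z)) * w (chart_inv F j (?r z)) = u (chart_inv M i z)"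
      using u z' regF by simp
  qed
  from pd_eqI[OF regM, of "(x, q)", simplified, OF q this]
  have pd: "pd M i b u (x, q) = V (\<xi> x) * D (?r (axis b 1)) + V' * \<xi> (?l (axis b 1)) * w q" for b .
  \<comment> \<open>A coordinate vector of the product lies in one factor, so one of the two terms
    of the product rule vanishes on it.\<close>
  have "?l (axis (Inl a) 1) = axis a 1" "?r (axis (Inl a) 1) = 0"
    "?l (axis (Inr k) 1) = 0" "?r (axis (Inr k) 1) = axis k 1" for a k
    by (simp_all add: vec_eq_iff axis_def)
  moreover have "D 0 = 0" "\<xi> 0 = 0"
    using has_derivative_bounded_linear[OF D] \<xi>_linear by (simp_all add: linear_simps)
  moreover have "pd F j k w q = D (axis k 1)"
    using pd_eqI[OF regF q D] .
  ultimately show "pd M i (Inl a) u (x, q) = \<alpha> $ a * V' * w q"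
    and "pd M i (Inr k) u (x, q) = V (\<xi> x) * pd F j k w q"
    by (simp_all add: pd \<xi>_axis)
qed

subsection \<open>Christoffel symbols\<close>

text \<open>\<open>\<theta>\<close> and \<open>L\<close> are logarithmic derivatives.
  \<open>Q \<alpha>\<close> is \<open>f\<close> times the differential of \<open>f\<close>, with the
  factor \<open>\<phi>^2\<close> that raising an index with the conformal metric produces. Primed
  names are explicit formulas, shown below to be the derivatives.\<close>

definition \<theta> :: "real \<Rightarrow> real" where "\<theta> t = deriv \<phi> t / \<phi> t"
definition \<theta>' :: "real \<Rightarrow> real" where "\<theta>' t = deriv (deriv \<phi>) t / \<phi> t - (\<theta> t)\<^sup>2"
definition L :: "real \<Rightarrow> real" where "L t = deriv f t / f t"
definition L' :: "real \<Rightarrow> real" where "L' t = deriv (deriv f) t / f t - (L t)\<^sup>2"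
definition Q :: "real \<Rightarrow> real" where "Q t = f t * deriv f t * (\<phi> t)\<^sup>2"
definition Q' :: "real \<Rightarrow> real" where
  "Q' t = (deriv f t)\<^sup>2 * (\<phi> t)\<^sup>2 + f t * deriv (deriv f) t * (\<phi> t)\<^sup>2
     + 2 * f t * deriv f t * \<phi> t * deriv \<phi> t"

lemma f_nz [simp]: "f t \<noteq> 0" and \<phi>_nz' [simp]: "\<phi> t \<noteq> 0"
  using f_pos[of t] \<phi>_nz[of t] by simp_all

lemmas DERIVs =
  smooth_on_DERIV[OF smooth_\<phi>] smooth_on_DERIV[OF smooth_f]

lemma DERIV_\<theta>: "(\<theta> has_real_derivative \<theta>' t) (at t)"
  unfolding \<theta>_def[abs_def] \<theta>'_def
  by (auto intro!: derivative_eq_intros DERIVs simp: field_simps power2_eq_square)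

lemma DERIV_L: "(L has_real_derivative L' t) (at t)"
  unfolding L_def[abs_def] L'_def
  by (auto intro!: derivative_eq_intros DERIVs simp: field_simps power2_eq_square)

lemma DERIV_Q: "(Q has_real_derivative Q' t) (at t)"
  unfolding Q_def[abs_def] Q'_def
  by (auto intro!: derivative_eq_intros DERIVs simp: field_simps power2_eq_square)

lemma pd_base:
  assumes "\<And>x q. q \<in> chart_dom F j \<Longrightarrow> u (x, q) = V (\<xi> x)"
    and "(V has_real_derivative V') (at (\<xi> x))" and "q \<in> chart_dom F j"
  shows "pd M i (Inl a) u (x, q) = \<alpha> $ a * V'" "pd M i (Inr k) u (x, q) = 0"
  using pd_separated[of u V "\<lambda>_. 1"] assms by simp_all

lemma pd_fibre:
  assumes "\<And>x q. q \<in> chart_dom F j \<Longrightarrow> u (x, q) = w q"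
    and "chart_differentiable F j w q" and "q \<in> chart_dom F j"
  shows "pd M i (Inl a) u (x, q) = 0" "pd M i (Inr k) u (x, q) = pd F j k w q"
  using pd_separated[of u "\<lambda>_. 1" w 0] assms by simp_all

lemma pd_zero:
  assumes "\<And>x q. q \<in> chart_dom F j \<Longrightarrow> u (x, q) = 0" and "q \<in> chart_dom F j"
  shows "pd M i k u (x, q) = 0"
  using pd_cong[OF regM, of "(x, q)" u "\<lambda>_. 0"] assms by auto

text \<open>Each entry of a diagonal block is a function of \<xi> times a function on the fibre. The
  profiles are multiples of \<open>1 / \<phi>^2\<close> and \<open>f^2\<close>, with logarithmic
  derivatives \<open>-2 \<theta>\<close> and \<open>2 L\<close>.\<close>

lemma pd_metric:
  assumes q: "q \<in> chart_dom F j"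
  shows "pd M i (Inl c) (\<lambda>p. metric_comp M i p $ Inl a $ Inl b) (x, q) =
      (if a = b then - 2 * \<epsilon> a * \<alpha> $ c * \<theta> (\<xi> x) / (\<phi> (\<xi> x))\<^sup>2 else 0)"
    and "pd M i (Inr k) (\<lambda>p. metric_comp M i p $ Inl a $ Inl b) (x, q) = 0"
    and "pd M i (Inl c) (\<lambda>p. metric_comp M i p $ Inr r $ Inr s) (x, q) =
      2 * \<alpha> $ c * L (\<xi> x) * (f (\<xi> x))\<^sup>2 * g q $ r $ s"
    and "pd M i (Inr k) (\<lambda>p. metric_comp M i p $ Inr r $ Inr s) (x, q) =
      (f (\<xi> x))\<^sup>2 * pd F j k (\<lambda>q. g q $ r $ s) q"
    and "pd M i l (\<lambda>p. metric_comp M i p $ Inl a $ Inr s) (x, q) = 0"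
    and "pd M i l (\<lambda>p. metric_comp M i p $ Inr r $ Inl b) (x, q) = 0"
proof -
  have 1: "((\<lambda>t. (if a = b then \<epsilon> a / (\<phi> t)\<^sup>2 else 0)) has_real_derivative
      (if a = b then - 2 * \<epsilon> a * \<theta> t / (\<phi> t)\<^sup>2 else 0)) (at t)" for t
    by (auto intro!: derivative_eq_intros DERIVs simp: \<theta>_def field_simps power2_eq_square)
  have 2: "((\<lambda>t. (f t)\<^sup>2) has_real_derivative 2 * L t * (f t)\<^sup>2) (at t)" for t
    by (auto intro!: derivative_eq_intros DERIVs simp: L_def field_simps power2_eq_square)
  show "pd M i (Inl c) (\<lambda>p. metric_comp M i p $ Inl a $ Inl b) (x, q) =
      (if a = b then - 2 * \<epsilon> a * \<alpha> $ c * \<theta> (\<xi> x) / (\<phi> (\<xi> x))\<^sup>2 else 0)"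
    "pd M i (Inr k) (\<lambda>p. metric_comp M i p $ Inl a $ Inl b) (x, q) = 0"
    by (subst pd_base[OF _ 1 q]; simp add: metric_comp_M)+
  note sep = pd_separated[OF _ 2 metric_comp_differentiable(1)[OF F j q, of r s] q]
  show "pd M i (Inl c) (\<lambda>p. metric_comp M i p $ Inr r $ Inr s) (x, q) =
      2 * \<alpha> $ c * L (\<xi> x) * (f (\<xi> x))\<^sup>2 * g q $ r $ s"
    "pd M i (Inr k) (\<lambda>p. metric_comp M i p $ Inr r $ Inr s) (x, q) =
      (f (\<xi> x))\<^sup>2 * pd F j k (\<lambda>q. g q $ r $ s) q"
    by (subst sep; simp add: metric_comp_M)+
  show "pd M i l (\<lambda>p. metric_comp M i p $ Inl a $ Inr s) (x, q) = 0"
    "pd M i l (\<lambda>p. metric_comp M i p $ Inr r $ Inl b) (x, q) = 0"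
    by (rule pd_zero[OF _ q]; simp add: metric_comp_M)+
qed

lemma invertible_g: "q \<in> chart_dom F j \<Longrightarrow> invertible (g q)"
  using F j by (simp add: semi_riemannian_manifold_def)

lemma g_sym: "q \<in> chart_dom F j \<Longrightarrow> g q $ r $ s = g q $ s $ r"
proof -
  assume "q \<in> chart_dom F j"
  then have "transpose (g q) $ r $ s = g q $ r $ s"
    using F j by (simp add: semi_riemannian_manifold_def)
  then show ?thesis
    by (simp add: transpose_def)
qed

lemma metric_inv:
  assumes q: "q \<in> chart_dom F j"
  shows "matrix_inv (metric_comp M i (x, q)) =
    block_diag (\<chi> a b. if a = b then \<epsilon> a * (\<phi> (\<xi> x))\<^sup>2 else 0) (inverse ((f (\<xi> x))\<^sup>2) *\<^sub>R matrix_inv (g q))"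
proof -
  \<comment> \<open>A sign is its own reciprocal.\<close>
  have "1 / (\<epsilon> a / (\<phi> (\<xi> x))\<^sup>2) = \<epsilon> a * (\<phi> (\<xi> x))\<^sup>2" for a
    using sign[of a] by auto
  then show ?thesis
    using matrix_inv_diag[of "\<lambda>a. \<epsilon> a / (\<phi> (\<xi> x))\<^sup>2"] matrix_inv_scaleR[of "(f (\<xi> x))\<^sup>2" "g q"]
    by (simp add: metric_comp_M matrix_inv_block_diag invertible_g[OF q] cong: if_cong)
qed

text \<open>In \<open>christoffel\<close> the summed index of the metric stands last, so
  \<open>g^-1 g = 1\<close> is combined with the symmetry of \<open>g\<close>.\<close>

lemma metric_inv_mult:
  assumes "q \<in> chart_dom F j"
  shows "(\<Sum>e\<in>UNIV. matrix_inv (g q) $ k $ e * g q $ r $ e) = (if k = r then 1 else 0)"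
proof -
  have "(matrix_inv (g q) ** g q) $ k $ r = mat 1 $ k $ r"
    using matrix_inv_right_mult[OF invertible_g[OF assms]] matrix_left_right_inverse by metis
  then show ?thesis
    by (simp add: matrix_matrix_mult_def mat_def g_sym[OF assms, of r])
qed

text \<open>The inverse metric is block diagonal, so an upper index sees only metric derivatives
  with an index of the same kind. This leaves the conformal symbols on the base, those of
  \<open>F\<close> on the fibre, and two mixed kinds produced by the base derivative of
  \<open>f^2\<close>.\<close>

lemma christoffel_M:
  assumes q: "q \<in> chart_dom F j"
  shows "christoffel M i (Inl c) (Inl a) (Inl b) (x, q) = - \<theta> (\<xi> x) * K c a b"
    and "christoffel M i (Inl c) (Inr r) (Inr s) (x, q) = - Q (\<xi> x) * (\<epsilon> c * \<alpha> $ c * g q $ r $ s)"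
    and "christoffel M i (Inl c) (Inl a) (Inr s) (x, q) = 0"
    and "christoffel M i (Inl c) (Inr s) (Inl a) (x, q) = 0"
    and "christoffel M i (Inr k) (Inl a) (Inr s) (x, q) = L (\<xi> x) * (if k = s then \<alpha> $ a else 0)"
    and "christoffel M i (Inr k) (Inr s) (Inl a) (x, q) = L (\<xi> x) * (if k = s then \<alpha> $ a else 0)"
    and "christoffel M i (Inr k) (Inl a) (Inl b) (x, q) = 0"
    and "christoffel M i (Inr k) (Inr r) (Inr s) (x, q) = \<Gamma> k r s q"
proof -
  note simps = christoffel_def sum_UNIV_sum_type pd_metric[OF q] metric_inv[OF q]
    mult_delta_left sum.delta
  show "christoffel M i (Inl c) (Inl a) (Inl b) (x, q) = - \<theta> (\<xi> x) * K c a b"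
    by (simp add: simps K_def)
  show "christoffel M i (Inl c) (Inr r) (Inr s) (x, q) = - Q (\<xi> x) * (\<epsilon> c * \<alpha> $ c * g q $ r $ s)"
    by (simp add: simps Q_def L_def sum_negf power2_eq_square)
  show "christoffel M i (Inl c) (Inl a) (Inr s) (x, q) = 0"
    "christoffel M i (Inl c) (Inr s) (Inl a) (x, q) = 0"
    "christoffel M i (Inr k) (Inl a) (Inl b) (x, q) = 0"
    by (simp_all add: simps)
  \<comment> \<open>The warping factors cancel, and contracting the fibre metric with its inverse
    leaves a Kronecker delta.\<close>
  have "(\<Sum>e\<in>UNIV. inverse ((f (\<xi> x))\<^sup>2) * matrix_inv (g q) $ k $ e *
      (2 * \<alpha> $ a * L (\<xi> x) * (f (\<xi> x))\<^sup>2 * g q $ s $ e)) =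
      2 * \<alpha> $ a * L (\<xi> x) * (\<Sum>e\<in>UNIV. matrix_inv (g q) $ k $ e * g q $ s $ e)"
    unfolding sum_distrib_left by (intro sum.cong) auto
  then show "christoffel M i (Inr k) (Inl a) (Inr s) (x, q) = L (\<xi> x) * (if k = s then \<alpha> $ a else 0)"
    "christoffel M i (Inr k) (Inr s) (Inl a) (x, q) = L (\<xi> x) * (if k = s then \<alpha> $ a else 0)"
    by (simp_all add: simps metric_inv_mult[OF q])
  \<comment> \<open>Factoring \<open>f^2\<close> out of the three metric derivatives lets it cancel
    the factor in the inverse metric.\<close>
  show "christoffel M i (Inr k) (Inr r) (Inr s) (x, q) = \<Gamma> k r s q"
    by (simp add: simps flip: distrib_left right_diff_distrib)
      (intro sum.cong, auto)
qed

text \<open>The symbols have profiles \<open>-\<theta>\<close>, \<open>-Q\<close>, \<open>L\<close>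
  or a constant. Fibre derivatives of a symbol with upper base index and two lower fibre indices are
  absent: the trace defining \<open>ricci\<close> never produces them.\<close>

lemma pd_christoffel_M:
  assumes q: "q \<in> chart_dom F j"
  shows "pd M i (Inl e) (christoffel M i (Inl c) (Inl a) (Inl b)) (x, q) = - \<theta>' (\<xi> x) * \<alpha> $ e * K c a b"
    and "pd M i (Inr l) (christoffel M i (Inl c) (Inl a) (Inl b)) (x, q) = 0"
    and "pd M i (Inl e) (christoffel M i (Inl c) (Inr r) (Inr s)) (x, q) =
      - Q' (\<xi> x) * \<alpha> $ e * (\<epsilon> c * \<alpha> $ c * g q $ r $ s)"
    and "pd M i z (christoffel M i (Inl c) (Inl a) (Inr s)) (x, q) = 0"
    and "pd M i z (christoffel M i (Inl c) (Inr s) (Inl a)) (x, q) = 0"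
    and "pd M i (Inl e) (christoffel M i (Inr k) (Inl a) (Inr s)) (x, q) =
      L' (\<xi> x) * \<alpha> $ e * (if k = s then \<alpha> $ a else 0)"
    and "pd M i (Inr l) (christoffel M i (Inr k) (Inl a) (Inr s)) (x, q) = 0"
    and "pd M i (Inl e) (christoffel M i (Inr k) (Inr s) (Inl a)) (x, q) =
      L' (\<xi> x) * \<alpha> $ e * (if k = s then \<alpha> $ a else 0)"
    and "pd M i (Inr l) (christoffel M i (Inr k) (Inr s) (Inl a)) (x, q) = 0"
    and "pd M i z (christoffel M i (Inr k) (Inl a) (Inl b)) (x, q) = 0"
    and "pd M i (Inl e) (christoffel M i (Inr k) (Inr r) (Inr s)) (x, q) = 0"
    and "pd M i (Inr l) (christoffel M i (Inr k) (Inr r) (Inr s)) (x, q) = pd F j l (\<Gamma> k r s) q"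
proof -
  have 1: "((\<lambda>t. - \<theta> t * K c a b) has_real_derivative - \<theta>' t * K c a b) (at t)" for t
    by (auto intro!: derivative_eq_intros DERIV_\<theta>)
  have 2: "((\<lambda>t. - Q t * (\<epsilon> c * \<alpha> $ c)) has_real_derivative - Q' t * (\<epsilon> c * \<alpha> $ c)) (at t)" for t
    by (auto intro!: derivative_eq_intros DERIV_Q)
  have 3: "((\<lambda>t. L t * (if k = s then \<alpha> $ a else 0)) has_real_derivative
      L' t * (if k = s then \<alpha> $ a else 0)) (at t)" for t
    by (auto intro!: derivative_eq_intros DERIV_L)
  show "pd M i (Inl e) (christoffel M i (Inl c) (Inl a) (Inl b)) (x, q) = - \<theta>' (\<xi> x) * \<alpha> $ e * K c a b"
    "pd M i (Inr l) (christoffel M i (Inl c) (Inl a) (Inl b)) (x, q) = 0"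
    by (subst pd_base[OF _ 1 q]; simp add: christoffel_M)+
  show "pd M i (Inl e) (christoffel M i (Inl c) (Inr r) (Inr s)) (x, q) =
      - Q' (\<xi> x) * \<alpha> $ e * (\<epsilon> c * \<alpha> $ c * g q $ r $ s)"
    by (subst pd_separated[OF _ 2 metric_comp_differentiable(1)[OF F j q, of r s] q]; simp add: christoffel_M)
  show "pd M i (Inl e) (christoffel M i (Inr k) (Inl a) (Inr s)) (x, q) =
      L' (\<xi> x) * \<alpha> $ e * (if k = s then \<alpha> $ a else 0)"
    "pd M i (Inr l) (christoffel M i (Inr k) (Inl a) (Inr s)) (x, q) = 0"
    "pd M i (Inl e) (christoffel M i (Inr k) (Inr s) (Inl a)) (x, q) =
      L' (\<xi> x) * \<alpha> $ e * (if k = s then \<alpha> $ a else 0)"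
    "pd M i (Inr l) (christoffel M i (Inr k) (Inr s) (Inl a)) (x, q) = 0"
    by (subst pd_base[OF _ 3 q]; simp add: christoffel_M)+
  show "pd M i (Inl e) (christoffel M i (Inr k) (Inr r) (Inr s)) (x, q) = 0"
    "pd M i (Inr l) (christoffel M i (Inr k) (Inr r) (Inr s)) (x, q) = pd F j l (\<Gamma> k r s) q"
    by (subst pd_fibre[OF _ christoffel_differentiable[OF F j q] q]; simp add: christoffel_M)+
  show "pd M i z (christoffel M i (Inl c) (Inl a) (Inr s)) (x, q) = 0"
    "pd M i z (christoffel M i (Inl c) (Inr s) (Inl a)) (x, q) = 0"
    "pd M i z (christoffel M i (Inr k) (Inl a) (Inl b)) (x, q) = 0"
    by (rule pd_zero[OF _ q]; simp add: christoffel_M)+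
qed

subsection \<open>Ricci tensor\<close>

lemma sum_K_\<alpha>: "(\<Sum>a\<in>UNIV. \<alpha> $ a * K a b c) = 2 * \<alpha> $ b * \<alpha> $ c - (if b = c then \<epsilon> b * S else 0)"
  by (simp add: K_def S_def algebra_simps sum.distrib sum_subtractf mult_delta_right sum.delta
      sum_distrib_left power2_eq_square)

text \<open>One Kronecker term contributes \<alpha> once for every index; the other two terms of
  \<open>K\<close> cancel.\<close>

lemma sum_K_trace: "(\<Sum>a\<in>UNIV. K a a c) = real CARD('n) * \<alpha> $ c"
  "(\<Sum>a\<in>UNIV. K a c a) = real CARD('n) * \<alpha> $ c"
  by (simp_all add: K_def algebra_simps sum.distrib sum_subtractf sum.delta)

text \<open>The first term of \<open>K\<close> gives \<open>S\<close> on the diagonal; the other two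
  contribute equal amounts with opposite signs.\<close>

lemma sum_K_\<epsilon>\<alpha>: "(\<Sum>e\<in>UNIV. \<epsilon> e * \<alpha> $ e * K a b e) = (if a = b then S else 0)"
  by (simp add: K_def S_def algebra_simps sum.distrib sum_subtractf mult_delta_right sum.delta
      power2_eq_square)

lemma sum_K_K: "(\<Sum>a\<in>UNIV. \<Sum>e\<in>UNIV. K a b e * K e a c) =
    (real CARD('n) + 2) * \<alpha> $ b * \<alpha> $ c - (if b = c then 2 * \<epsilon> b * S else 0)"
proof -
  have "(\<Sum>e\<in>UNIV. K a b e * K e a c) =
      \<alpha> $ c * K a b a + \<alpha> $ a * K a b c - (if a = c then if a = b then \<epsilon> a * S else 0 else 0)" for a
  proof -
    \<comment> \<open>Only the second factor is expanded: two of its terms fix \<open>e\<close>, and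
      the third leaves the contraction \<open>sum_K_\<epsilon>\<alpha>\<close>.\<close>
    have "(\<Sum>e\<in>UNIV. K a b e * K e a c) =
        (\<Sum>e\<in>UNIV. K a b e * (if e = a then \<alpha> $ c else 0)) + (\<Sum>e\<in>UNIV. K a b e * (if e = c then \<alpha> $ a else 0))
        - (if a = c then \<epsilon> a else 0) * (\<Sum>e\<in>UNIV. \<epsilon> e * \<alpha> $ e * K a b e)"
      unfolding sum_distrib_left sum.distrib[symmetric] sum_subtractf[symmetric]
      by (intro sum.cong) (auto simp: K_def[of _ a c] algebra_simps)
    then show ?thesis
      by (simp add: sum_K_\<epsilon>\<alpha> mult_delta_right sum.delta)
  qed
  then have "(\<Sum>a\<in>UNIV. \<Sum>e\<in>UNIV. K a b e * K e a c) =
      \<alpha> $ c * (\<Sum>a\<in>UNIV. K a b a) + (\<Sum>a\<in>UNIV. \<alpha> $ a * K a b c)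
      - (\<Sum>a\<in>UNIV. if a = c then if a = b then \<epsilon> a * S else 0 else 0)"
    by (simp add: sum.distrib sum_subtractf sum_distrib_left)
  then show ?thesis
    by (cases "b = c") (simp_all add: sum_K_trace sum_K_\<alpha> algebra_simps)
qed

text \<open>The trace splits over base and fibre indices. The base part is the Ricci tensor of the
  conformally flat metric; the \<open>m\<close> fibre indices contribute equal summands, which bring
  in \<open>L\<close>.\<close>

lemma ricci_base:
  assumes q: "q \<in> chart_dom F j"
  defines "n \<equiv> real CARD('n)" and "m \<equiv> real CARD('m)"
  shows "ricci M i (Inl b) (Inl c) (x, q) =
    \<alpha> $ b * \<alpha> $ c * ((n - 2) * (\<theta>' (\<xi> x) + (\<theta> (\<xi> x))\<^sup>2) - m * (L' (\<xi> x) + (L (\<xi> x))\<^sup>2) - 2 * m * L (\<xi> x) * \<theta> (\<xi> x))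
    + (if b = c then \<epsilon> b * S * (\<theta>' (\<xi> x) - (n - 2) * (\<theta> (\<xi> x))\<^sup>2 + m * L (\<xi> x) * \<theta> (\<xi> x)) else 0)"
proof -
  let ?t = "\<xi> x"
  \<comment> \<open>The base symbols are \<open>-\<theta> K\<close> with constant \<open>K\<close>,
    so the derivative terms are linear in \<open>K\<close> with factor \<open>\<theta>'\<close> and
    the products are quadratic in \<open>K\<close> with factor \<open>\<theta>^2\<close>.\<close>
  have base: "(\<Sum>a\<in>UNIV. riemann M i (Inl a) (Inl c) (Inl a) (Inl b) (x, q)) =
      - \<theta>' ?t * (\<Sum>a\<in>UNIV. \<alpha> $ a * K a b c) + \<theta>' ?t * \<alpha> $ b * (\<Sum>a\<in>UNIV. K a a c)
      + (\<theta> ?t)\<^sup>2 * ((\<Sum>e\<in>UNIV. (\<Sum>a\<in>UNIV. K a a e) * K e b c) - (\<Sum>a\<in>UNIV. \<Sum>e\<in>UNIV. K a b e * K e a c))"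
    unfolding sum_distrib_right sum.swap[of "\<lambda>e a. K a a e * K e b c"]
    by (simp add: riemann_def sum_UNIV_sum_type christoffel_M[OF q] pd_christoffel_M[OF q]
        sum.distrib sum_subtractf sum_distrib_left sum_negf power2_eq_square algebra_simps)
  have tr: "(\<Sum>e\<in>UNIV. (\<Sum>a\<in>UNIV. K a a e) * K e b c) = n * (\<Sum>e\<in>UNIV. \<alpha> $ e * K e b c)"
    by (simp add: sum_K_trace n_def sum_distrib_left mult.assoc)
  \<comment> \<open>The right-hand side does not involve \<open>k\<close>, so summation multiplies
    it by \<open>m\<close>.\<close>
  have fibre: "riemann M i (Inr k) (Inl c) (Inr k) (Inl b) (x, q) =
      - (L' ?t + (L ?t)\<^sup>2) * \<alpha> $ b * \<alpha> $ c - L ?t * \<theta> ?t * (\<Sum>e\<in>UNIV. \<alpha> $ e * K e b c)" for k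
    by (simp add: riemann_def sum_UNIV_sum_type christoffel_M[OF q] pd_christoffel_M[OF q]
        sum_distrib_left sum_negf sum_subtractf mult_delta_left mult_delta_right sum.delta power2_eq_square algebra_simps)
  show ?thesis
    unfolding ricci_def sum_UNIV_sum_type base fibre tr
    unfolding sum_K_\<alpha> sum_K_trace sum_K_K sum_constant
    by (cases "b = c") (simp_all add: n_def m_def power2_eq_square algebra_simps)
qed

lemma \<Gamma>_sym: "q \<in> chart_dom F j \<Longrightarrow> \<Gamma> k r s q = \<Gamma> k s r q"
  by (rule christoffel_sym[OF F j])

text \<open>The only surviving products are \<open>L \<alpha>\<close> times a fibre symbol. They
  cancel in pairs, using the symmetry of the lower indices of \<open>\<Gamma>\<close>.\<close>

lemma ricci_mixed:
  assumes q: "q \<in> chart_dom F j"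
  shows "ricci M i (Inl b) (Inr s) (x, q) = 0" "ricci M i (Inr s) (Inl b) (x, q) = 0"
  using \<Gamma>_sym[OF q]
  by (simp_all add: ricci_def riemann_def sum_UNIV_sum_type christoffel_M[OF q] pd_christoffel_M[OF q]
      mult_delta_left mult_delta_right sum.delta sum.distrib sum_subtractf algebra_simps)

text \<open>Fibre indices of the trace give the Ricci tensor of \<open>F\<close> and
  \<open>(1 - m) L Q\<close>; base indices give the remaining terms, including one further
  \<open>L Q\<close>. Hence the coefficient \<open>2 - m\<close>.\<close>

lemma ricci_fibre:
  assumes q: "q \<in> chart_dom F j"
  defines "n \<equiv> real CARD('n)" and "m \<equiv> real CARD('m)"
  shows "ricci M i (Inr r) (Inr s) (x, q) = ricci F j r s q
    + g q $ r $ s * S * (- Q' (\<xi> x) + n * \<theta> (\<xi> x) * Q (\<xi> x) + (2 - m) * L (\<xi> x) * Q (\<xi> x))"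
proof -
  let ?t = "\<xi> x"
  have S: "(\<Sum>a\<in>UNIV. \<alpha> $ a * (\<epsilon> a * \<alpha> $ a)) = S"
    by (simp add: S_def power2_eq_square algebra_simps)
  have riem: "riemann M i (Inl a) (Inr s) (Inl a) (Inr r) (x, q) =
      g q $ r $ s * (- Q' ?t * (\<alpha> $ a * (\<epsilon> a * \<alpha> $ a)) + \<theta> ?t * Q ?t * (\<Sum>e\<in>UNIV. K a a e * (\<epsilon> e * \<alpha> $ e))
        + L ?t * Q ?t * (\<alpha> $ a * (\<epsilon> a * \<alpha> $ a)))" for a
    by (simp add: riemann_def sum_UNIV_sum_type christoffel_M[OF q] pd_christoffel_M[OF q]
        sum_distrib_left sum_distrib_right sum.distrib mult_delta_right sum.delta algebra_simps)
  \<comment> \<open>On the diagonal \<open>sum_K_\<epsilon>\<alpha>\<close> gives \<open>S\<close>,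
    once for each base index.\<close>
  have tr: "(\<Sum>a\<in>UNIV. \<Sum>e\<in>UNIV. K a a e * (\<epsilon> e * \<alpha> $ e)) = n * S"
  proof -
    have "(\<Sum>a\<in>UNIV. \<Sum>e\<in>UNIV. K a a e * (\<epsilon> e * \<alpha> $ e)) =
        (\<Sum>a::'n\<in>UNIV. S)"
      using sum_K_\<epsilon>\<alpha>[of a a for a] by (simp add: mult.commute)
    then show ?thesis
      by (simp add: n_def)
  qed
  have base: "(\<Sum>a\<in>UNIV. riemann M i (Inl a) (Inr s) (Inl a) (Inr r) (x, q)) =
      g q $ r $ s * S * (- Q' ?t + n * \<theta> ?t * Q ?t + L ?t * Q ?t)"
    unfolding riem
    by (simp only: sum_distrib_left[symmetric] sum.distrib S tr) (simp add: algebra_simps)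
  \<comment> \<open>As in the Gauss equation: the sums over fibre indices rebuild the curvature of
    \<open>F\<close>, while those over base indices add products of a \<open>Q\<close> symbol with
    an \<open>L\<close> symbol.\<close>
  have riem': "riemann M i (Inr k) (Inr s) (Inr k) (Inr r) (x, q) = riemann F j k s k r q
      - L ?t * Q ?t * (\<Sum>a\<in>UNIV. \<alpha> $ a * (\<epsilon> a * \<alpha> $ a)) * g q $ r $ s
      + (if k = r then L ?t * Q ?t * (\<Sum>a\<in>UNIV. \<alpha> $ a * (\<epsilon> a * \<alpha> $ a)) * g q $ k $ s else 0)" for k
    by (simp add: riemann_def sum_UNIV_sum_type christoffel_M[OF q] pd_christoffel_M[OF q]
        sum_distrib_left sum_distrib_right sum.distrib sum_negf sum_subtractf algebra_simps)
  show ?thesis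
    unfolding ricci_def sum_UNIV_sum_type base riem' S
    by (simp add: sum.distrib sum_subtractf sum.delta m_def algebra_simps)
qed

subsection \<open>Hessian and the soliton equation\<close>

text \<open>\<open>H\<close> depends on \<xi> alone, so only symbols with upper base index
  contribute. The fibre block therefore comes entirely from the \<open>Q\<close> symbols.\<close>

lemma hess_M:
  fixes h :: "real \<Rightarrow> real"
  assumes h: "smooth_on UNIV h" and q: "q \<in> chart_dom F j"
  defines "H \<equiv> \<lambda>(x, q). h (\<xi> x)"
  shows "hess M H i (Inl a) (Inl b) (x, q) =
      \<alpha> $ a * \<alpha> $ b * (deriv (deriv h) (\<xi> x) + 2 * \<theta> (\<xi> x) * deriv h (\<xi> x))
      - (if a = b then \<epsilon> a * S * \<theta> (\<xi> x) * deriv h (\<xi> x) else 0)"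
    and "hess M H i (Inl a) (Inr s) (x, q) = 0"
    and "hess M H i (Inr s) (Inl a) (x, q) = 0"
    and "hess M H i (Inr r) (Inr s) (x, q) = g q $ r $ s * S * Q (\<xi> x) * deriv h (\<xi> x)"
proof -
  \<comment> \<open>Stated at every point of the chart, because these first derivatives are
    differentiated again.\<close>
  have H1: "pd M i (Inl b) H (x, q) = \<alpha> $ b * deriv h (\<xi> x)" "pd M i (Inr k) H (x, q) = 0"
    if "q \<in> chart_dom F j" for b k x q
    by (subst pd_base[OF _ smooth_on_DERIV(1)[OF h] that]; simp add: H_def)+
  have D2: "((\<lambda>t. \<alpha> $ b * deriv h t) has_real_derivative \<alpha> $ b * deriv (deriv h) t) (at t)" for b t
    by (intro DERIV_cmult smooth_on_DERIV(2)[OF h])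
  have H2: "pd M i (Inl a) (pd M i (Inl b) H) (x, q) = \<alpha> $ a * (\<alpha> $ b * deriv (deriv h) (\<xi> x))"
    "pd M i (Inr r) (pd M i (Inl b) H) (x, q) = 0" "pd M i z (pd M i (Inr s) H) (x, q) = 0" for a b r s z
    by (subst pd_base[OF _ D2[of b] q]; simp add: H1)+ (rule pd_zero[OF _ q]; simp add: H1)
  note simps = hess_def sum_UNIV_sum_type christoffel_M[OF q] H1[OF q] H2
  have "(\<Sum>c\<in>UNIV. - \<theta> (\<xi> x) * K c a b * (\<alpha> $ c * deriv h (\<xi> x))) =
      - \<theta> (\<xi> x) * deriv h (\<xi> x) * (\<Sum>c\<in>UNIV. \<alpha> $ c * K c a b)"
    by (simp add: sum_distrib_left algebra_simps)
  then show "hess M H i (Inl a) (Inl b) (x, q) =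
      \<alpha> $ a * \<alpha> $ b * (deriv (deriv h) (\<xi> x) + 2 * \<theta> (\<xi> x) * deriv h (\<xi> x))
      - (if a = b then \<epsilon> a * S * \<theta> (\<xi> x) * deriv h (\<xi> x) else 0)"
    unfolding sum_K_\<alpha> by (simp add: simps algebra_simps)
  show "hess M H i (Inl a) (Inr s) (x, q) = 0" "hess M H i (Inr s) (Inl a) (x, q) = 0"
    by (simp_all add: simps)
  show "hess M H i (Inr r) (Inr s) (x, q) = g q $ r $ s * S * Q (\<xi> x) * deriv h (\<xi> x)"
    by (simp add: simps S_def sum_distrib_left sum_distrib_right sum_negf power2_eq_square algebra_simps)
qed

lemma rank_one_plus_diagonal_zero:
  fixes \<beta> :: "real^'n"
  assumes "\<beta> \<noteq> 0" "CARD('n) \<ge> 2"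
    and eq: "\<And>a b. \<beta> $ a * \<beta> $ b * A + (if a = b then \<epsilon> a * B else 0) = 0"
  shows "A = 0" "B = 0"
proof -
  obtain a where a: "\<beta> $ a \<noteq> 0"
    using assms(1) by (auto simp: vec_eq_iff)
  \<comment> \<open>A second index is needed to reach an off-diagonal entry, where the diagonal part
    is absent.\<close>
  have "UNIV \<noteq> {a}"
    using assms(2) by (metis card_1_singleton_iff One_nat_def numeral_le_one_iff semiring_norm(69))
  then obtain b where b: "b \<noteq> a"
    by blast
  show "A = 0"
  proof (rule ccontr)
    assume "A \<noteq> 0"
    \<comment> \<open>The off-diagonal entry kills this component; the diagonal entry at
      \<open>b\<close> then gives \<open>B = 0\<close>, and the one at \<open>a\<close> contradicts
      the choice of \<open>a\<close>.\<close>
    then have "\<beta> $ b = 0"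
      using eq[of a b] a b by simp
    then show False
      using eq[of b b] eq[of a a] a \<open>A \<noteq> 0\<close> by simp
  qed
  then show "B = 0"
    using eq[of a a] by simp
qed

text \<open>A nonzero component of \<alpha> lets one coordinate axis reach every value. Equations at
  points of the base thereby become equations for all real \<open>t\<close>.\<close>

lemma surj_\<xi>:
  assumes "\<alpha> \<noteq> 0"
  shows "\<exists>x. \<xi> x = t"
proof -
  obtain a where "\<alpha> $ a \<noteq> 0"
    using assms by (auto simp: vec_eq_iff)
  moreover have "\<xi> (axis a c) = \<alpha> $ a * c" for c
    by (simp add: \<xi>_def axis_def mult_delta_right sum.delta)
  ultimately show ?thesis
    by (intro exI[of _ "axis a (t / \<alpha> $ a)"]) simp
qed

lemma g_nonzero: "q \<in> chart_dom F j \<Longrightarrow> \<exists>r s. g q $ r $ s \<noteq> 0"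
proof (rule ccontr)
  assume "q \<in> chart_dom F j" "\<nexists>r s. g q $ r $ s \<noteq> 0"
  then show False
    \<comment> \<open>\<open>undefined\<close> serves as an arbitrary index: a diagonal entry of
      \<open>g^-1 g\<close> would be both 0 and 1.\<close>
    using metric_inv_mult[of q undefined undefined] by simp
qed

text \<open>The point \<open>q0\<close> guarantees that the chart is not empty: the tensor equation
  would otherwise hold vacuously and say nothing about the functions of \<xi>.\<close>

lemma soliton_in_chart:
  fixes h :: "real \<Rightarrow> real"
  assumes h: "smooth_on UNIV h" and q0: "q0 \<in> chart_dom F j"
    and einstein: "\<And>q r s. q \<in> chart_dom F j \<Longrightarrow> ricci F j r s q = lam * g q $ r $ s"
    and \<alpha>: "\<alpha> \<noteq> 0" and card: "CARD('n) \<ge> 2"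
  defines "n \<equiv> real CARD('n)" and "m \<equiv> real CARD('m)" and "H \<equiv> \<lambda>(x, q). h (\<xi> x)"
  shows "(\<forall>p\<in>chart_dom M i. \<forall>a b. ricci M i a b p + hess M H i a b p = \<rho> * metric_comp M i p $ a $ b)
    \<longleftrightarrow> (\<forall>t.
      (n - 2) * f t * deriv (deriv \<phi>) t + f t * \<phi> t * deriv (deriv h) t
        - m * \<phi> t * deriv (deriv f) t - 2 * m * deriv \<phi> t * deriv f t
        + 2 * f t * deriv \<phi> t * deriv h t = 0 \<and>
      S * (f t * \<phi> t * deriv (deriv \<phi>) t - (n - 1) * f t * (deriv \<phi> t)\<^sup>2
           + m * \<phi> t * deriv \<phi> t * deriv f t - f t * \<phi> t * deriv \<phi> t * deriv h t)
        = \<rho> * f t \<and>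
      S * (- f t * (\<phi> t)\<^sup>2 * deriv (deriv f) t + (n - 2) * f t * \<phi> t * deriv \<phi> t * deriv f t
           - (m - 1) * (\<phi> t)\<^sup>2 * (deriv f t)\<^sup>2 + f t * (\<phi> t)\<^sup>2 * deriv f t * deriv h t)
        = \<rho> * (f t)\<^sup>2 - lam)"
    (is "?lhs \<longleftrightarrow> (\<forall>t. ?E1 t = 0 \<and> ?E2 t = \<rho> * f t \<and> ?E3 t = \<rho> * (f t)\<^sup>2 - lam)")
proof -
  \<comment> \<open>\<open>A\<close>, \<open>B\<close> and \<open>C\<close> are the coefficients of
    \<open>\<alpha>\<alpha>\<close>, of the flat metric and of the fibre metric in
    \<open>Ric + Hess h - \<rho> g\<close>.\<close>
  define A where "A t = (n - 2) * (\<theta>' t + (\<theta> t)\<^sup>2) - m * (L' t + (L t)\<^sup>2) - 2 * m * L t * \<theta> t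
    + deriv (deriv h) t + 2 * \<theta> t * deriv h t" for t
  define B where "B t = S * (\<theta>' t - (n - 2) * (\<theta> t)\<^sup>2 + m * L t * \<theta> t - \<theta> t * deriv h t)
    - \<rho> / (\<phi> t)\<^sup>2" for t
  define C where "C t = S * (- Q' t + n * \<theta> t * Q t + (2 - m) * L t * Q t + Q t * deriv h t)
    + lam - \<rho> * (f t)\<^sup>2" for t
  \<comment> \<open>Clearing denominators: the system differs from \<open>A\<close>,
    \<open>B\<close>, \<open>C\<close> only by the nonvanishing factors \<open>f \<phi>\<close>,
    \<open>f \<phi>^2\<close> and 1.\<close>
  have E1: "?E1 t = f t * \<phi> t * A t" for t
    by (simp add: A_def \<theta>'_def L'_def \<theta>_def L_def field_simps power2_eq_square)
  have E2: "?E2 t - \<rho> * f t = f t * (\<phi> t)\<^sup>2 * B t" for t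
    by (simp add: B_def \<theta>'_def \<theta>_def L_def field_simps power2_eq_square)
  have E3: "?E3 t - (\<rho> * (f t)\<^sup>2 - lam) = C t" for t
    by (simp add: C_def Q_def Q'_def \<theta>_def L_def field_simps power2_eq_square)
  have base: "ricci M i (Inl a) (Inl b) (x, q) + hess M H i (Inl a) (Inl b) (x, q)
      - \<rho> * metric_comp M i (x, q) $ Inl a $ Inl b
      = \<alpha> $ a * \<alpha> $ b * A (\<xi> x) + (if a = b then \<epsilon> a * B (\<xi> x) else 0)"
    if q: "q \<in> chart_dom F j" for a b x q
    unfolding hess_M(1)[OF h q, folded H_def] ricci_base[OF q]
    by (cases "a = b") (simp_all add: metric_comp_M A_def B_def n_def m_def algebra_simps)
  have fibre: "ricci M i (Inr r) (Inr s) (x, q) + hess M H i (Inr r) (Inr s) (x, q)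
      - \<rho> * metric_comp M i (x, q) $ Inr r $ Inr s = g q $ r $ s * C (\<xi> x)"
    if q: "q \<in> chart_dom F j" for r s x q
    unfolding hess_M(4)[OF h q, folded H_def] ricci_fibre[OF q] einstein[OF q]
    by (simp add: metric_comp_M C_def n_def m_def algebra_simps)
  have mixed: "ricci M i (Inl a) (Inr s) (x, q) + hess M H i (Inl a) (Inr s) (x, q)
      = \<rho> * metric_comp M i (x, q) $ Inl a $ Inr s"
    "ricci M i (Inr s) (Inl a) (x, q) + hess M H i (Inr s) (Inl a) (x, q)
      = \<rho> * metric_comp M i (x, q) $ Inr s $ Inl a" if q: "q \<in> chart_dom F j" for a s x q
    using hess_M(2,3)[OF h q, folded H_def] ricci_mixed[OF q] by (simp_all add: metric_comp_M)
  have "?lhs \<longleftrightarrow> (\<forall>t. A t = 0 \<and> B t = 0 \<and> C t = 0)"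
  proof
    assume lhs: ?lhs
    show "\<forall>t. A t = 0 \<and> B t = 0 \<and> C t = 0"
    proof
      fix t
      obtain x where x: "\<xi> x = t"
        using surj_\<xi>[OF \<alpha>] by blast
      obtain r s where rs: "g q0 $ r $ s \<noteq> 0"
        \<comment> \<open>A nonzero entry of the fibre metric is what allows \<open>C t = 0\<close>
          to be read off.\<close>
        using g_nonzero[OF q0] by blast
      have "(x, q0) \<in> chart_dom M i"
        using q0 by simp
      note eq = lhs[THEN bspec, OF this, rule_format]
      have AB: "\<alpha> $ a * \<alpha> $ b * A t + (if a = b then \<epsilon> a * B t else 0) = 0" for a b
        using base[OF q0, of a b x] eq[of "Inl a" "Inl b"] unfolding x by simp
      have "g q0 $ r $ s * C t = 0"
        using fibre[OF q0, of r s x] eq[of "Inr r" "Inr s"] unfolding x by simp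
      then show "A t = 0 \<and> B t = 0 \<and> C t = 0"
        using rank_one_plus_diagonal_zero[OF \<alpha> card AB] rs by simp
    qed
  next
    assume ABC: "\<forall>t. A t = 0 \<and> B t = 0 \<and> C t = 0"
    have "ricci M i a b (x, q) + hess M H i a b (x, q) = \<rho> * metric_comp M i (x, q) $ a $ b"
      if q: "q \<in> chart_dom F j" for x q a b
    proof -
      have "ricci M i (Inl a) (Inl b) (x, q) + hess M H i (Inl a) (Inl b) (x, q)
          = \<rho> * metric_comp M i (x, q) $ Inl a $ Inl b" for a b
        by (rule right_minus_eq[THEN iffD1]) (simp only: base[OF q], simp add: ABC)
      moreover have "ricci M i (Inr r) (Inr s) (x, q) + hess M H i (Inr r) (Inr s) (x, q)
          = \<rho> * metric_comp M i (x, q) $ Inr r $ Inr s" for r s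
        by (rule right_minus_eq[THEN iffD1]) (simp only: fibre[OF q], simp add: ABC)
      ultimately show ?thesis
        using mixed[OF q] by (cases a; cases b) (simp_all only:)
    qed
    then show ?lhs
      by auto
  qed
  also have "\<dots> \<longleftrightarrow> (\<forall>t. ?E1 t = 0 \<and> ?E2 t - \<rho> * f t = 0 \<and> ?E3 t - (\<rho> * (f t)\<^sup>2 - lam) = 0)"
    unfolding E1 E2 E3 by simp
  finally show ?thesis
    by (simp only: right_minus_eq)
qed

end

section \<open>Passage from one chart to the whole manifold, and the two cases for
  \<open>S\<close>\<close>

theorem theorem1p3:
  fixes \<epsilon> :: "'n::finite \<Rightarrow> real"
    and \<alpha> :: "real^'n"
    and \<phi> f h :: "real \<Rightarrow> real"
    and F :: "('j, 'q, 'm::finite) semi_riem"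
    and lam \<rho> :: real
  defines "\<xi> \<equiv> (\<lambda>x::real^'n. \<Sum>i\<in>UNIV. \<alpha> $ i * x $ i)"
    and "S \<equiv> (\<Sum>k\<in>UNIV. \<epsilon> k * (\<alpha> $ k)\<^sup>2)"
    and "n \<equiv> real CARD('n)"
    and "m \<equiv> real CARD('m)"
  defines "M \<equiv> warped_product
        (conformal (\<lambda>x. 1 / (\<phi> (\<xi> x))\<^sup>2) (pseudo_euclidean \<epsilon>)) (\<lambda>x. f (\<xi> x)) F"
  assumes "CARD('n) \<ge> 3"
    and "\<And>i. \<epsilon> i \<in> {1, -1}"
    and "\<alpha> \<noteq> 0"
    and "S \<in> {1, -1} \<or> S = 0"
    and "smooth_on UNIV \<phi>" and "smooth_on UNIV f" and "smooth_on UNIV h"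
    and "\<And>t. f t > 0"
    and "\<And>t. \<phi> t \<noteq> 0"
    and "einstein_manifold F lam"
  shows "gradient_ricci_soliton M (\<lambda>(x, q). h (\<xi> x)) \<rho> \<longleftrightarrow>
    (S \<in> {1, -1} \<longrightarrow>
       (\<forall>t.
          (n - 2) * f t * deriv (deriv \<phi>) t + f t * \<phi> t * deriv (deriv h) t
            - m * \<phi> t * deriv (deriv f) t - 2 * m * deriv \<phi> t * deriv f t
            + 2 * f t * deriv \<phi> t * deriv h t = 0 \<and>
          S * (f t * \<phi> t * deriv (deriv \<phi>) t - (n - 1) * f t * (deriv \<phi> t)\<^sup>2
               + m * \<phi> t * deriv \<phi> t * deriv f t - f t * \<phi> t * deriv \<phi> t * deriv h t)
            = \<rho> * f t \<and>
          S * (- f t * (\<phi> t)\<^sup>2 * deriv (deriv f) t + (n - 2) * f t * \<phi> t * deriv \<phi> t * deriv f t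
               - (m - 1) * (\<phi> t)\<^sup>2 * (deriv f t)\<^sup>2 + f t * (\<phi> t)\<^sup>2 * deriv f t * deriv h t)
            = \<rho> * (f t)\<^sup>2 - lam)) \<and>
    (S = 0 \<longrightarrow>
       (\<forall>t.
          (n - 2) * f t * deriv (deriv \<phi>) t + f t * \<phi> t * deriv (deriv h) t
            - m * \<phi> t * deriv (deriv f) t - 2 * m * deriv \<phi> t * deriv f t
            + 2 * f t * deriv \<phi> t * deriv h t = 0) \<and>
       \<rho> = 0 \<and> lam = 0)"
proof -
  have F: "semi_riemannian_manifold F"
    using assms(15) by (simp add: einstein_manifold_def)
  have W: "warped_over_line \<epsilon> \<phi> f F j" if "j \<in> chart_ids F" for j
    by unfold_locales (use assms F that in auto)
  let ?sol = "\<lambda>j. \<forall>p\<in>chart_dom M ((), j). \<forall>a b.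
    ricci M ((), j) a b p + hess M (\<lambda>(x, q). h (\<xi> x)) ((), j) a b p = \<rho> * metric_comp M ((), j) p $ a $ b"
  let ?sys = "\<forall>t.
      (n - 2) * f t * deriv (deriv \<phi>) t + f t * \<phi> t * deriv (deriv h) t
        - m * \<phi> t * deriv (deriv f) t - 2 * m * deriv \<phi> t * deriv f t
        + 2 * f t * deriv \<phi> t * deriv h t = 0 \<and>
      S * (f t * \<phi> t * deriv (deriv \<phi>) t - (n - 1) * f t * (deriv \<phi> t)\<^sup>2
           + m * \<phi> t * deriv \<phi> t * deriv f t - f t * \<phi> t * deriv \<phi> t * deriv h t)
        = \<rho> * f t \<and>
      S * (- f t * (\<phi> t)\<^sup>2 * deriv (deriv f) t + (n - 2) * f t * \<phi> t * deriv \<phi> t * deriv f t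
           - (m - 1) * (\<phi> t)\<^sup>2 * (deriv f t)\<^sup>2 + f t * (\<phi> t)\<^sup>2 * deriv f t * deriv h t)
        = \<rho> * (f t)\<^sup>2 - lam"
  \<comment> \<open>The system does not mention \<open>j\<close>, so every chart with nonempty
    domain yields the same condition.\<close>
  have chart: "?sol j \<longleftrightarrow> ?sys" if j: "j \<in> chart_ids F" and q: "q \<in> chart_dom F j" for j q
  proof -
    interpret W: warped_over_line \<epsilon> \<alpha> \<phi> f F j
      by (rule W[OF j])
    have "W.\<xi> = \<xi>" "W.S = S"
      by (simp_all add: fun_eq_iff W.\<xi>_def W.S_def \<xi>_def S_def)
    moreover from this have "W.M = M"
      by (simp add: W.M_def M_def)
    moreover have "ricci F j r s p = lam * metric_comp F j p $ r $ s" if "p \<in> chart_dom F j" for p r s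
      using assms(15) j that by (simp add: einstein_manifold_def)
    ultimately show ?thesis
      using W.soliton_in_chart[OF assms(12) q, of lam \<rho>] assms(6,8) by (simp add: n_def m_def)
  qed
  have dom: "chart_ids M = {()} \<times> chart_ids F" "chart_dom M ((), j) = UNIV \<times> chart_dom F j" for j
    by (simp_all add: M_def warped_product_def conformal_def pseudo_euclidean_def)
  have "smooth_manifold F"
    using F by (simp add: semi_riemannian_manifold_def)
  \<comment> \<open>A manifold is nonempty and covered by its charts; this supplies a chart in which
    the soliton equation forces the system.\<close>
  then obtain j0 q0 where j0: "j0 \<in> chart_ids F" "q0 \<in> chart_dom F j0"
    unfolding smooth_manifold_def by blast
  have "gradient_ricci_soliton M (\<lambda>(x, q). h (\<xi> x)) \<rho> \<longleftrightarrow> (\<forall>j\<in>chart_ids F. ?sol j)"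
    by (simp add: gradient_ricci_soliton_def dom)
  also have "\<dots> \<longleftrightarrow> ?sys"
  proof
    assume "\<forall>j\<in>chart_ids F. ?sol j"
    from bspec[OF this j0(1)] show ?sys
      by (rule chart[OF j0, THEN iffD1])
  next
    assume sys: ?sys
    show "\<forall>j\<in>chart_ids F. ?sol j"
    proof
      fix j assume j: "j \<in> chart_ids F"
      show "?sol j"
      \<comment> \<open>Charts with empty domain are permitted by the definition, and over them the
        equation is vacuous.\<close>
      proof (cases "chart_dom F j = {}")
        case True
        then show ?thesis
          by (simp add: dom)
      next
        case False
        then obtain q where "q \<in> chart_dom F j"
          by blast
        from chart[OF j this, THEN iffD2, OF sys] show ?thesis .
      qed
    qed
  qed
  finally have soliton: "gradient_ricci_soliton M (\<lambda>(x, q). h (\<xi> x)) \<rho> \<longleftrightarrow> ?sys" .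
  show ?thesis
  proof (cases "S = 0")
    \<comment> \<open>With \<open>S = 0\<close> the last two equations read
      \<open>0 = \<rho> f\<close> and \<open>0 = \<rho> f^2 - lam\<close>; positivity of
      \<open>f\<close> gives \<rho> = 0 and then \<open>lam = 0\<close>.\<close>
    case True
    then show ?thesis
      unfolding soliton using assms(13) by (auto simp: less_imp_neq[symmetric])
  next
    case False
    then have "S \<in> {1, -1}"
      using assms(9) by blast
    then show ?thesis
      unfolding soliton using False by (simp only: simp_thms)
  qed
qed

end
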